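(* Let $0<\alpha<1$, let $\beta\in[0,1]$, and let $j$ be an integer such that $\alpha^{j}<\beta\le\alpha^{j-1}$. Let $C_n$ be the cycle on $n\ge3$ vertices. If $n>j$ and $2\alpha^{j}<\beta$, then $\mathrm{Z}_{\alpha,\beta}(C_n)=\lceil\frac{n}{j}\rceil$, and if $n>j$ and $\beta\le2\alpha^{j}$, then $\mathrm{Z}_{\alpha,\beta}(C_n)=\lceil\frac{2n}{2j+1}\rceil$. If $n\le j$, then $\mathrm{Z}_{\alpha,\beta}(C_n)=2$.
   Context: All graphs are finite and simple. Let $\alpha,\beta\in[0,1]$ (the transmission proportion and the transmission threshold), let $G$ be a graph and $B\subseteq V(G)$ a set of initially filled vertices. The transmission forcing process started from $B$ is defined as follows. Put $B_0=B$, $w_0(v)=1$ for $v\in B$ and $w_0(v)=0$ for $v\in V(G)\setminus B$. For $t\ge 1$, given the set $B_{t-1}$ of vertices filled at time $t-1$ and the weights $w_{t-1}$: for each unfilled vertex $u\in V(G)\setminus B_{t-1}$ let $\mathcal V_{t,u}$ be the set of all $v\in B_{t-1}$ such that $u$ is the only neighbor of $v$ in $V(G)\setminus B_{t-1}$ and $v\notin \mathcal V_{s,u'}$ for every $s<t$ and every $u'$ (each vertex transmits weight at most once); when $v\in\mathcal V_{t,u}$ we say $v$ forces $u$, written $v\to u$. Set $w_t(u)=w_{t-1}(u)+\sum_{v\in\mathcal V_{t,u}}\alpha\, w_{t-1}(v)$ for $u\in V(G)\setminus B_{t-1}$ and $w_t(u)=w_{t-1}(u)$ for $u\in B_{t-1}$.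 Then $B_t=B_{t-1}\cup\{u\in V(G)\setminus B_{t-1} : w_t(u)\ge\beta\}$. The set $B$ is an $(\alpha,\beta)$-transmission zero forcing set of $G$ if $B_t=V(G)$ for some $t\ge 0$, and the $(\alpha,\beta)$-transmission zero forcing number $\mathrm{Z}_{\alpha,\beta}(G)$ is the minimum cardinality of such a set. *)

theory Defs
  imports Complex_Main "Graph_Theory.Pair_Digraph"
begin

text \<open>
  A finite simple graph is a \<^const>\<open>pair_graph\<close>: finitely many vertices and a symmetric
  irreflexive arc relation, each edge \<open>uv\<close> being the two arcs \<open>(u, v)\<close> and \<open>(v, u)\<close>.
\<close>

definition cycle_graph :: "nat \<Rightarrow> nat pair_pre_digraph" where
  "cycle_graph n =
    \<lparr> pverts = {..<n},
      parcs = {(u, v). u < n \<and> v < n \<and> (v = Suc u mod n \<or> u = Suc v mod n)} \<rparr>"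

lemma pair_graph_cycle_graph:
  assumes "n \<ge> 3"
  shows "pair_graph (cycle_graph n)"
proof -
  have no_loop: "Suc u mod n \<noteq> u" if "u < n" for u
    using that assms by (cases "Suc u = n") auto
  have "finite (parcs (cycle_graph n))"
    by (rule finite_subset[of _ "{..<n} \<times> {..<n}"]) (auto simp: cycle_graph_def)
  moreover have "symmetric (with_proj (cycle_graph n))"
    unfolding symmetric_def with_proj_simps by (rule symI) (simp add: cycle_graph_def disj_commute)
  moreover have "fst e \<noteq> snd e" if "e \<in> parcs (cycle_graph n)" for e
  proof (cases e)
    case (Pair u v)
    then have "u < n" "v < n" "v = Suc u mod n \<or> u = Suc v mod n"
      using that by (simp_all add: cycle_graph_def)
    then show ?thesis
      using Pair no_loop[of u] by (metis fst_conv snd_conv)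
  qed
  ultimately show ?thesis
    by unfold_locales (simp_all add: cycle_graph_def case_prod_beta)
qed

text \<open>
  The state at time \<open>t\<close>: the set \<open>B\<^sub>t\<close> of filled vertices, the weights \<open>w\<^sub>t\<close>, and the vertices
  that lie in \<open>\<V>\<^bsub>s,u\<^esub>\<close> for some \<open>s \<le> t\<close> and some \<open>u\<close>, i.e. that have already
  transmitted. A vertex is spent even if its transmission did not fill the receiving vertex.
\<close>

record 'a tf_state =
  filled :: "'a set"
  weight :: "'a \<Rightarrow> real"
  spent :: "'a set"

definition unfilled :: "'a pair_pre_digraph \<Rightarrow> 'a tf_state \<Rightarrow> 'a set" where
  "unfilled G S = pverts G - filled S"

definition forcers :: "'a pair_pre_digraph \<Rightarrow> 'a tf_state \<Rightarrow> 'a \<Rightarrow> 'a set" where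
  "forcers G S u =
    {v \<in> filled S. {x \<in> unfilled G S. (v, x) \<in> parcs G} = {u} \<and> v \<notin> spent S}"

definition next_weight :: "real \<Rightarrow> 'a pair_pre_digraph \<Rightarrow> 'a tf_state \<Rightarrow> 'a \<Rightarrow> real" where
  "next_weight \<alpha> G S u =
    (if u \<in> unfilled G S then weight S u + (\<Sum>v \<in> forcers G S u. \<alpha> * weight S v)
     else weight S u)"

definition tf_step :: "real \<Rightarrow> real \<Rightarrow> 'a pair_pre_digraph \<Rightarrow> 'a tf_state \<Rightarrow> 'a tf_state" where
  "tf_step \<alpha> \<beta> G S =
    \<lparr> filled = filled S \<union> {u \<in> unfilled G S. next_weight \<alpha> G S u \<ge> \<beta>},
      weight = next_weight \<alpha> G S,
      spent = spent S \<union> (\<Union>u \<in> unfilled G S. forcers G S u) \<rparr>"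

definition tf_init :: "'a set \<Rightarrow> 'a tf_state" where
  "tf_init B = \<lparr> filled = B, weight = (\<lambda>v. if v \<in> B then 1 else 0), spent = {} \<rparr>"

primrec tf_process ::
  "real \<Rightarrow> real \<Rightarrow> 'a pair_pre_digraph \<Rightarrow> 'a set \<Rightarrow> nat \<Rightarrow> 'a tf_state" where
  "tf_process \<alpha> \<beta> G B 0 = tf_init B"
| "tf_process \<alpha> \<beta> G B (Suc t) = tf_step \<alpha> \<beta> G (tf_process \<alpha> \<beta> G B t)"

definition transmission_zero_forcing_set ::
  "real \<Rightarrow> real \<Rightarrow> 'a pair_pre_digraph \<Rightarrow> 'a set \<Rightarrow> bool" where
  "transmission_zero_forcing_set \<alpha> \<beta> G B \<longleftrightarrow>
    B \<subseteq> pverts G \<and> (\<exists>t. filled (tf_process \<alpha> \<beta> G B t) = pverts G)"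

definition transmission_zero_forcing_number ::
  "real \<Rightarrow> real \<Rightarrow> 'a pair_pre_digraph \<Rightarrow> nat" where
  "transmission_zero_forcing_number \<alpha> \<beta> G =
    (LEAST k. \<exists>B. transmission_zero_forcing_set \<alpha> \<beta> G B \<and> card B = k)"

text \<open>The minimum is over a nonempty set, so \<^const>\<open>Least\<close> is attained.\<close>

lemma transmission_zero_forcing_set_verts:
  "transmission_zero_forcing_set \<alpha> \<beta> G (pverts G)"
  unfolding transmission_zero_forcing_set_def
  by (auto intro!: exI[of _ 0] simp: tf_init_def)

end

theory Submission
  imports Defs
begin

text \<open>
  Each vertex forces at most once, so the forces form a partial function. If all degrees are at
  most 2, a vertex with two forcers has no neighbour left to force; hence the weights along the
  chain starting at an initial vertex are the powers of \<open>\<alpha>\<close>, and the chain contains at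
  most \<open>j\<close> vertices before it reaches a doubly forced one. A vertex on none of the truncated
  chains is doubly forced with total weight \<open>2\<alpha>\<^sup>j\<close> and consumes the ends of two chains, so
  \<open>2n \<le> (2j+1)\<bar>B\<bar>\<close>, and \<open>n \<le> j\<bar>B\<bar>\<close> if \<open>2\<alpha>\<^sup>j < \<beta>\<close>. Conversely, put adjacent pairs of
  initial vertices at period \<open>c = 2j+1\<close> (resp. \<open>2j\<close>), with a truncated last period or a single extra
  vertex: at a stalled time each side of a gap has penetrated at least \<open>j - 1\<close> steps, which already
  fills gaps of length \<open>c - 2\<close>.
\<close>

section \<open>Invariants of the process and of its forces\<close>

declare tf_process.simps(2) [simp del]

text \<open>Positivity of \<open>\<beta>\<close> prevents a vertex of weight 0 from being filled, so
  every filled vertex outside \<open>B\<close> has a forcer.\<close>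

locale transmission_process = pair_graph G for G :: "'a pair_pre_digraph" +
  fixes \<alpha> \<beta> :: real and B :: "'a set"
  assumes alpha_pos: "0 < \<alpha>" and beta_pos: "0 < \<beta>" and B_subset: "B \<subseteq> pverts G"
begin

abbreviation state :: "nat \<Rightarrow> 'a tf_state" where
  "state \<equiv> tf_process \<alpha> \<beta> G B"

text \<open>The forces \<open>v \<rightarrow> u\<close> performed at the times \<open>1, \<dots>, t\<close>.\<close>

definition forces :: "nat \<Rightarrow> ('a \<times> 'a) set" where
  "forces t = {(v, u). \<exists>s<t. u \<in> unfilled G (state s) \<and> v \<in> forcers G (state s) u}"

lemma filled_Suc:
  "filled (state (Suc t)) = filled (state t) \<union>
    {u \<in> unfilled G (state t). \<beta> \<le> next_weight \<alpha> G (state t) u}"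
  by (simp add: tf_process.simps tf_step_def)

lemma weight_Suc: "weight (state (Suc t)) = next_weight \<alpha> G (state t)"
  by (simp add: tf_process.simps tf_step_def)

lemma spent_Suc:
  "spent (state (Suc t)) =
    spent (state t) \<union> (\<Union>u \<in> unfilled G (state t). forcers G (state t) u)"
  by (simp add: tf_process.simps tf_step_def)

lemma filled_mono: "s \<le> t \<Longrightarrow> filled (state s) \<subseteq> filled (state t)"
  by (rule lift_Suc_mono_le[of "\<lambda>t. filled (state t)"]) (auto simp: filled_Suc)

lemma spent_mono: "s \<le> t \<Longrightarrow> spent (state s) \<subseteq> spent (state t)"
  by (rule lift_Suc_mono_le[of "\<lambda>t. spent (state t)"]) (auto simp: spent_Suc)

lemma filled_verts: "filled (state t) \<subseteq> pverts G"
  using B_subset by (induction t) (auto simp: tf_init_def filled_Suc unfilled_def)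

lemma B_filled: "B \<subseteq> filled (state t)"
  using filled_mono[of 0 t] by (simp add: tf_init_def)

lemma forces_0: "forces 0 = {}"
  by (simp add: forces_def)

lemma forces_Suc:
  "(v, u) \<in> forces (Suc t) \<longleftrightarrow>
    (v, u) \<in> forces t \<or> u \<in> unfilled G (state t) \<and> v \<in> forcers G (state t) u"
  by (auto simp: forces_def less_Suc_eq)

text \<open>Being unspent at \<open>s\<close> and spent at \<open>Suc s\<close> pins
  \<open>s\<close> down as the only time at which \<open>v\<close> transmits.\<close>

lemma forcesE:
  assumes "(v, u) \<in> forces t"
  obtains s where "s < t" "v \<in> filled (state s)" "u \<in> unfilled G (state s)"
    "{x \<in> unfilled G (state s). (v, x) \<in> parcs G} = {u}" "v \<notin> spent (state s)"
    "v \<in> spent (state (Suc s))"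
proof -
  from assms obtain s where "s < t" "u \<in> unfilled G (state s)" "v \<in> forcers G (state s) u"
    unfolding forces_def by blast
  moreover from this have "v \<in> spent (state (Suc s))" unfolding spent_Suc by blast
  ultimately show ?thesis using that unfolding forcers_def by blast
qed

lemma forces_arc: "(v, u) \<in> forces t \<Longrightarrow> (v, u) \<in> parcs G"
  by (erule forcesE) blast

lemma forces_rev_arc: "(v, u) \<in> forces t \<Longrightarrow> (u, v) \<in> parcs G"
  using forces_arc arcs_symmetric by metis

lemma forces_spent: "(v, u) \<in> forces t \<Longrightarrow> v \<in> spent (state t)"
  by (erule forcesE) (use spent_mono in \<open>meson Suc_leI subsetD\<close>)

lemma spent_forces: "v \<in> spent (state t) \<Longrightarrow> \<exists>u. (v, u) \<in> forces t"
  by (induction t) (auto simp: tf_init_def spent_Suc forces_Suc)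

lemma forces_filled: "(v, u) \<in> forces t \<Longrightarrow> v \<in> filled (state t)"
  by (erule forcesE) (use filled_mono in \<open>meson less_imp_le subsetD\<close>)

text \<open>A vertex turns spent at most once, so both forces happen at the same time, where the
  sole unfilled neighbour is determined.\<close>

lemma forces_single_valued: "single_valued (forces t)"
proof (rule single_valuedI)
  fix v u u' assume vu: "(v, u) \<in> forces t" and vu': "(v, u') \<in> forces t"
  from vu obtain s where
    s: "{x \<in> unfilled G (state s). (v, x) \<in> parcs G} = {u}" "v \<notin> spent (state s)"
      "v \<in> spent (state (Suc s))"
    by (rule forcesE)
  from vu' obtain s' where
    s': "{x \<in> unfilled G (state s'). (v, x) \<in> parcs G} = {u'}" "v \<notin> spent (state s')"
      "v \<in> spent (state (Suc s'))"
    by (rule forcesE)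
  have "\<not> s < s'" "\<not> s' < s"
    using s(2,3) s'(2,3) spent_mono[OF Suc_leI] by blast+
  then have "s = s'" by simp
  then show "u = u'" using s(1) s'(1) by simp
qed

text \<open>Opposite forces would require each endpoint to be filled at a time when the other is
  not, which monotonicity of \<open>filled\<close> forbids.\<close>

lemma forces_antisym:
  assumes vu: "(v, u) \<in> forces t"
  shows "(u, v) \<notin> forces t"
proof
  assume uv: "(u, v) \<in> forces t"
  from vu obtain s where s: "v \<in> filled (state s)" "u \<in> unfilled G (state s)"
    by (rule forcesE)
  from uv obtain s' where s': "u \<in> filled (state s')" "v \<in> unfilled G (state s')"
    by (rule forcesE)
  consider "s \<le> s'" | "s' \<le> s" by linarith
  then show False
    using s s' filled_mono unfolding unfilled_def by cases blast+
qed

lemma weight_filled: "v \<in> filled (state s) \<Longrightarrow> s \<le> t \<Longrightarrow> weight (state t) v = weight (state s) v"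
proof (induction t)
  case (Suc t)
  show ?case
  proof (cases "s = Suc t")
    case False
    then have "v \<in> filled (state t)" "s \<le> t" using Suc.prems filled_mono[of s t] by auto
    then show ?thesis using Suc unfolding weight_Suc by (auto simp: next_weight_def unfilled_def)
  qed simp
qed simp

lemma weight_B: "v \<in> B \<Longrightarrow> weight (state t) v = 1"
  using weight_filled[of v 0 t] by (simp add: tf_init_def)

lemma finite_forcers: "finite {v. (v, u) \<in> forces t}"
  by (rule finite_subset[OF _ pair_finite_verts]) (use forces_filled filled_verts in blast)

lemma forces_not_B: "(v, u) \<in> forces t \<Longrightarrow> u \<notin> B"
  by (erule forcesE) (use B_filled in \<open>auto simp: unfilled_def\<close>)

text \<open>A forcer is filled when it transmits, and from then on its weight is frozen. Its
  contribution can therefore be read off at the present time instead of at the time of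
  transmission.\<close>

lemma weight_eq:
  "u \<in> pverts G \<Longrightarrow> u \<notin> B \<Longrightarrow>
    weight (state t) u = (\<Sum>v | (v, u) \<in> forces t. \<alpha> * weight (state t) v)"
proof (induction t)
  case 0
  then show ?case by (simp add: tf_init_def forces_0)
next
  case (Suc t)
  have old: "weight (state (Suc t)) v = weight (state t) v" if "v \<in> filled (state t)" for v
    using weight_filled[OF that, of "Suc t"] by simp
  show ?case
  proof (cases "u \<in> unfilled G (state t)")
    case False
    then have "u \<in> filled (state t)" using Suc.prems by (auto simp: unfilled_def)
    moreover have "{v. (v, u) \<in> forces (Suc t)} = {v. (v, u) \<in> forces t}"
      using False by (auto simp: forces_Suc)
    ultimately show ?thesis
      using Suc old forces_filled by (auto intro!: sum.cong)
  next
    case True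
    have fin: "finite {v. (v, u) \<in> forces t}" "finite (forcers G (state t) u)"
      using finite_subset[OF _ finite_forcers[of u "Suc t"]] finite_forcers True
      by (auto simp: forces_Suc)
    have eq: "{v. (v, u) \<in> forces (Suc t)} = {v. (v, u) \<in> forces t} \<union> forcers G (state t) u"
      using True by (auto simp: forces_Suc)
    have "{v. (v, u) \<in> forces t} \<inter> forcers G (state t) u = {}"
      using forces_spent by (auto simp: forcers_def)
    then have "(\<Sum>v | (v, u) \<in> forces (Suc t). \<alpha> * weight (state (Suc t)) v) =
        (\<Sum>v | (v, u) \<in> forces t. \<alpha> * weight (state (Suc t)) v) +
        (\<Sum>v \<in> forcers G (state t) u. \<alpha> * weight (state (Suc t)) v)"
      unfolding eq using fin by (intro sum.union_disjoint)
    also have "\<dots> = weight (state t) u + (\<Sum>v \<in> forcers G (state t) u. \<alpha> * weight (state t) v)"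
      using Suc.IH[OF Suc.prems] forces_filled old
      by (auto intro!: arg_cong2[where f = "(+)"] sum.cong simp: forcers_def)
    also have "\<dots> = weight (state (Suc t)) u"
      unfolding weight_Suc using True by (simp add: next_weight_def)
    finally show ?thesis by simp
  qed
qed

lemma weight_filled_ge: "u \<in> filled (state t) \<Longrightarrow> u \<notin> B \<Longrightarrow> \<beta> \<le> weight (state t) u"
proof (induction t)
  case 0
  then show ?case by (simp add: tf_init_def)
next
  case (Suc t)
  show ?case
  proof (cases "u \<in> filled (state t)")
    case True
    then show ?thesis using Suc weight_filled[of u t "Suc t"] by simp
  next
    case False
    then show ?thesis using Suc.prems unfolding filled_Suc weight_Suc by simp
  qed
qed

lemma weight_nonneg: "0 \<le> weight (state t) v"
proof (induction t arbitrary: v)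
  case 0
  show ?case by (simp add: tf_init_def)
next
  case (Suc t)
  then show ?case
    unfolding weight_Suc using alpha_pos by (auto simp: next_weight_def intro!: add_nonneg_nonneg sum_nonneg)
qed

lemma sum_weight_le:
  assumes "A \<subseteq> {v. (v, u) \<in> forces t}" "A \<noteq> {}"
  shows "(\<Sum>v\<in>A. \<alpha> * weight (state t) v) \<le> weight (state t) u"
proof -
  obtain v where "(v, u) \<in> forces t" using assms by blast
  then have "u \<in> pverts G" "u \<notin> B" using forces_arc in_arcsD2 forces_not_B by blast+
  then show ?thesis
    using assms(1) finite_forcers alpha_pos weight_nonneg by (subst weight_eq) (auto intro!: sum_mono2)
qed

lemma filled_forced:
  assumes "u \<in> filled (state t)" "u \<notin> B"
  obtains v where "(v, u) \<in> forces t"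
proof -
  have "u \<in> pverts G" using assms filled_verts by auto
  then have "{v. (v, u) \<in> forces t} \<noteq> {}"
    using weight_filled_ge[OF assms] weight_eq[of u t] beta_pos assms by (metis not_le sum.empty)
  then show ?thesis using that by auto
qed

section \<open>Chains of forces and the lower bound\<close>

lemma forces_mono: "s \<le> t \<Longrightarrow> forces s \<subseteq> forces t"
  unfolding forces_def by (auto intro: less_le_trans)

text \<open>Backtracking through unique forcers ends in \<open>B\<close>, with one factor
  \<open>\<alpha>\<close> per step. The induction runs over \<open>t\<close>, while forces and
  weights are taken at the fixed time \<open>T\<close>, so that one relation serves for the whole
  chain.\<close>

lemma single_forcer_chain:
  assumes "v \<in> filled (state t)" and "t \<le> T" and "card {u. (u, v) \<in> forces T} \<le> 1"
    and branch: "\<And>x y. (x, y) \<in> forces T \<Longrightarrow> card {u. (u, x) \<in> forces T} \<le> 1"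
  shows "\<exists>b\<in>B. \<exists>d. (b, v) \<in> forces T ^^ d \<and> weight (state T) v = \<alpha> ^ d"
  using assms(1-3)
proof (induction t arbitrary: v)
  case 0
  then have "v \<in> B" by (simp add: tf_init_def)
  then show ?case using weight_B by (intro bexI[of _ v] exI[of _ 0]) auto
next
  case (Suc t)
  show ?case
  proof (cases "v \<in> filled (state t)")
    case True
    then show ?thesis using Suc by simp
  next
    case False
    then have "v \<notin> B" using B_filled by auto
    from filled_forced[OF Suc.prems(1) this] obtain u where u: "(u, v) \<in> forces (Suc t)" .
    have "u \<in> filled (state t)"
      by (rule forcesE[OF u]) (use filled_mono in \<open>meson less_Suc_eq_le subsetD\<close>)
    moreover have uT: "(u, v) \<in> forces T"
      using u forces_mono[OF Suc.prems(2)] by blast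
    ultimately obtain b d where b: "b \<in> B" "(b, u) \<in> forces T ^^ d" "weight (state T) u = \<alpha> ^ d"
      using Suc.IH[of u] Suc.prems(2) branch[OF uT] by auto
    have "{u. (u, v) \<in> forces T} = {u}"
      using Suc.prems(3) uT finite_forcers[of v T] card_le_Suc0_iff_eq[of "{u. (u, v) \<in> forces T}"]
      by auto
    moreover have "v \<in> pverts G" using Suc.prems(1) filled_verts by blast
    ultimately have "weight (state T) v = \<alpha> ^ Suc d"
      using weight_eq[of v T] \<open>v \<notin> B\<close> b(3) by simp
    then show ?thesis using b uT by (intro bexI[of _ b] exI[of _ "Suc d"]) auto
  qed
qed

lemma finite_B: "finite B"
  using B_subset pair_finite_verts by (rule finite_subset)

text \<open>As \<open>forces T\<close> is single-valued, a start \<open>b\<close> and a length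
  \<open>d\<close> determine at most one endpoint, and there are \<open>J * card B\<close> such
  pairs.\<close>

lemma
  shows finite_reached: "finite {v. \<exists>b\<in>B. \<exists>d<J. (b, v) \<in> forces T ^^ d}" (is "finite ?A")
    and card_reached_le: "card {v. \<exists>b\<in>B. \<exists>d<J. (b, v) \<in> forces T ^^ d} \<le> J * card B"
proof -
  \<comment> \<open>If the chain stops before length \<open>d\<close>, the value is arbitrary; only
    the inclusion of the reached set in the image matters.\<close>
  let ?f = "\<lambda>(b, d). THE v. (b, v) \<in> forces T ^^ d"
  have f: "v = ?f (b, d)" if "(b, v) \<in> forces T ^^ d" for b v d
    using that single_valued_relpow[OF forces_single_valued]
    by (auto simp: single_valued_def intro!: the_equality[symmetric])
  have sub: "?A \<subseteq> ?f ` (B \<times> {..<J})"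
  proof
    fix v assume "v \<in> ?A"
    then obtain b d where "b \<in> B" "d < J" "(b, v) \<in> forces T ^^ d" by blast
    then show "v \<in> ?f ` (B \<times> {..<J})" by (intro rev_image_eqI[of "(b, d)"] f) auto
  qed
  show "finite ?A" using sub by (rule finite_subset) (simp add: finite_B)
  have "card ?A \<le> card (B \<times> {..<J})"
    using sub by (intro surj_card_le) (auto simp: finite_B)
  then show "card ?A \<le> J * card B" by (simp add: card_cartesian_product mult.commute)
qed

text \<open>One of the at most two neighbours of \<open>x\<close> is its target \<open>y\<close>,
  which cannot force \<open>x\<close> in return.\<close>

lemma single_forcer_if_forces:
  assumes xy: "(x, y) \<in> forces T" and deg: "card {u. (x, u) \<in> parcs G} \<le> 2"
  shows "card {u. (u, x) \<in> forces T} \<le> 1"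
proof -
  have fin: "finite {u. (x, u) \<in> parcs G}"
    by (rule finite_subset[of _ "pverts G"]) (use pair_finite_verts in \<open>auto dest: in_arcsD2\<close>)
  have "{u. (u, x) \<in> forces T} \<subseteq> {u. (x, u) \<in> parcs G} - {y}"
    using forces_antisym[OF xy] forces_rev_arc by auto
  then have "card {u. (u, x) \<in> forces T} \<le> card ({u. (x, u) \<in> parcs G} - {y})"
    by (intro card_mono) (use fin in auto)
  then show ?thesis using deg fin forces_arc[OF xy] by (simp add: card_Diff_singleton)
qed

text \<open>With at most one forcer, \<open>v\<close> would lie on a chain of length below
  \<open>J\<close>, because weights on longer chains fall below \<open>\<beta>\<close>. So
  \<open>v\<close> has two forcers. Each of them forces, hence has at most one forcer and sits at
  depth below \<open>J\<close>; as no chain shorter than \<open>J\<close> reaches \<open>v\<close>,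
  that depth is \<open>J - 1\<close>, and each contributes \<open>\<alpha> ^ J\<close>.\<close>

lemma two_sources:
  assumes full: "filled (state T) = pverts G" and v: "v \<in> pverts G"
    and deg: "\<And>v. card {u. (v, u) \<in> parcs G} \<le> 2"
    and \<alpha>: "\<alpha> \<le> 1" "\<alpha> ^ J < \<beta>" "\<beta> \<le> 1"
    and no: "\<not> (\<exists>b\<in>B. \<exists>d<J. (b, v) \<in> forces T ^^ d)"
  shows "\<beta> \<le> 2 * \<alpha> ^ J" "\<exists>b1\<in>B. \<exists>b2\<in>B. b1 \<noteq> b2 \<and> (b1, v) \<in> forces T ^^ J \<and> (b2, v) \<in> forces T ^^ J"
proof -
  let ?R = "forces T"
  have branch: "card {u. (u, x) \<in> ?R} \<le> 1" if "(x, y) \<in> ?R" for x y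
    using single_forcer_if_forces[OF that deg] .
  have chain: "\<exists>b\<in>B. \<exists>d<J. (b, x) \<in> ?R ^^ d \<and> weight (state T) x = \<alpha> ^ d"
    if x: "x \<in> pverts G" "card {u. (u, x) \<in> ?R} \<le> 1" for x
  proof -
    obtain b d where b: "b \<in> B" "(b, x) \<in> ?R ^^ d" "weight (state T) x = \<alpha> ^ d"
      using single_forcer_chain[of x T T] x full branch by auto
    have "\<beta> \<le> weight (state T) x"
      using weight_filled_ge[of x T] weight_B[of x T] x full \<alpha>(3) by (cases "x \<in> B") auto
    then have "d < J" using b(3) \<alpha> power_decreasing[of J d \<alpha>] alpha_pos by (cases "J \<le> d") auto
    then show ?thesis using b by blast
  qed
  have fin: "finite {u. (v, u) \<in> parcs G}"
    by (rule finite_subset[of _ "pverts G"]) (use pair_finite_verts in \<open>auto dest: in_arcsD2\<close>)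
  have sub: "{u. (u, v) \<in> ?R} \<subseteq> {u. (v, u) \<in> parcs G}"
    using forces_rev_arc by auto
  have "\<not> card {u. (u, v) \<in> ?R} \<le> 1" using chain[OF v] no by blast
  then have "card {u. (u, v) \<in> ?R} = 2" using card_mono[OF fin sub] deg[of v] by simp
  then obtain u1 u2 where u: "{u. (u, v) \<in> ?R} = {u1, u2}" "u1 \<noteq> u2"
    by (auto simp: card_2_iff)
  have uR: "(u1, v) \<in> ?R" "(u2, v) \<in> ?R" using u by auto
  have reach: "\<exists>b\<in>B. \<exists>d. Suc d = J \<and> (b, x) \<in> ?R ^^ d \<and> weight (state T) x = \<alpha> ^ d"
    if x: "(x, v) \<in> ?R" for x
  proof -
    have "x \<in> pverts G" using forces_filled[OF x] full by simp
    from chain[OF this branch[OF x]] obtain b d where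
      b: "b \<in> B" "d < J" "(b, x) \<in> ?R ^^ d" "weight (state T) x = \<alpha> ^ d" by blast
    have "(b, v) \<in> ?R ^^ Suc d" using b(3) x by auto
    then have "Suc d = J" using no b(1,2) by (metis Suc_lessI)
    then show ?thesis using b by blast
  qed
  obtain b1 d where b1: "b1 \<in> B" "Suc d = J" "(b1, u1) \<in> ?R ^^ d" "weight (state T) u1 = \<alpha> ^ d"
    using reach[OF uR(1)] by blast
  obtain b2 where b2: "b2 \<in> B" "(b2, u2) \<in> ?R ^^ d" "weight (state T) u2 = \<alpha> ^ d"
    using reach[OF uR(2)] b1(2) by blast
  have "v \<notin> B" using forces_not_B uR by blast
  then show "\<beta> \<le> 2 * \<alpha> ^ J"
    using weight_filled_ge[of v T] weight_eq[of v T] v full u b1 b2 by auto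
  \<comment> \<open>A common start would have a single endpoint after \<open>d\<close> steps,
    contrary to \<open>u1 \<noteq> u2\<close>.\<close>
  have "b1 \<noteq> b2"
    using b1(3) b2(2) u(2) single_valued_relpow[OF forces_single_valued[of T], of d]
    by (auto simp: single_valued_def)
  moreover have "(b1, v) \<in> ?R ^^ J" "(b2, v) \<in> ?R ^^ J"
    using b1(3) b2(2) uR unfolding b1(2)[symmetric] by (auto intro: relpow_Suc_I)
  ultimately show "\<exists>b1\<in>B. \<exists>b2\<in>B. b1 \<noteq> b2 \<and> (b1, v) \<in> ?R ^^ J \<and> (b2, v) \<in> ?R ^^ J"
    using b1 b2 by blast
qed

context
  fixes T J :: nat
  assumes full: "filled (state T) = pverts G"
    and deg: "\<And>v. card {u. (v, u) \<in> parcs G} \<le> 2"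
    and params: "\<alpha> \<le> 1" "\<alpha> ^ J < \<beta>" "\<beta> \<le> 1"
begin

lemma card_verts_le_strong:
  assumes "2 * \<alpha> ^ J < \<beta>"
  shows "card (pverts G) \<le> J * card B"
proof -
  let ?A = "{v. \<exists>b\<in>B. \<exists>d<J. (b, v) \<in> forces T ^^ d}"
  have "pverts G \<subseteq> ?A"
  proof
    fix v assume "v \<in> pverts G"
    then show "v \<in> ?A" using two_sources(1)[OF full _ deg params, of v] assms by fastforce
  qed
  from card_mono[OF finite_reached this] card_reached_le show ?thesis by (rule le_trans)
qed

text \<open>The truncated chains \<open>A\<close> cover at most \<open>J * card B\<close> vertices.
  Each vertex of the rest \<open>D\<close> is reached by \<open>J\<close> forces from two initial
  vertices, and no initial vertex serves two members of \<open>D\<close>, so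
  \<open>2 * card D \<le> card B\<close>.\<close>

lemma card_verts_le: "2 * card (pverts G) \<le> (2 * J + 1) * card B"
proof -
  define A where "A = {v. \<exists>b\<in>B. \<exists>d<J. (b, v) \<in> forces T ^^ d}"
  define D where "D = pverts G - A"
  define src where "src v = {b \<in> B. (b, v) \<in> forces T ^^ J}" for v
  have finsrc: "finite (src v)" for v using finite_B by (simp add: src_def)
  have "2 \<le> card (src v)" if "v \<in> D" for v
  proof -
    obtain b1 b2 where "b1 \<noteq> b2" "{b1, b2} \<subseteq> src v"
      using two_sources(2)[OF full _ deg params, of v] \<open>v \<in> D\<close>
      unfolding D_def A_def src_def by blast
    then show ?thesis using card_mono[OF finsrc, of "{b1, b2}" v] by simp
  qed
  then have "2 * card D \<le> (\<Sum>v\<in>D. card (src v))"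
    using sum_mono[of D "\<lambda>_. 2" "\<lambda>v. card (src v)"] by simp
  also have "\<dots> = card (\<Union>v\<in>D. src v)"
  proof (rule card_UN_disjoint[symmetric])
    show "finite D" using pair_finite_verts by (simp add: D_def)
    show "\<forall>v\<in>D. \<forall>v'\<in>D. v \<noteq> v' \<longrightarrow> src v \<inter> src v' = {}"
      using single_valued_relpow[OF forces_single_valued[of T], of J]
      unfolding src_def single_valued_def by blast
  qed (use finsrc in simp)
  also have "\<dots> \<le> card B"
    by (intro card_mono finite_B) (auto simp: src_def)
  finally have "2 * card D \<le> card B" .
  moreover have "card (pverts G) \<le> card (A \<union> D)"
    using finite_reached pair_finite_verts by (intro card_mono) (auto simp: A_def D_def)
  moreover have "card (A \<union> D) \<le> card A + card D" by (rule card_Un_le)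
  moreover have "card A \<le> J * card B" unfolding A_def by (rule card_reached_le)
  ultimately show ?thesis by simp
qed

end

text \<open>
  One stationary step suffices: after it, every filled vertex with a single unfilled neighbour has
  transmitted (see \<open>sole_unfilled_forced\<close> below).
\<close>

lemma ex_stalled: "\<exists>T. filled (state (Suc T)) = filled (state T)"
proof (rule ccontr)
  assume *: "\<nexists>T. filled (state (Suc T)) = filled (state T)"
  have "t \<le> card (filled (state t))" for t
  proof (induction t)
    case (Suc t)
    have "filled (state t) \<subset> filled (state (Suc t))"
      using * filled_mono[of t "Suc t"] by auto
    then have "card (filled (state t)) < card (filled (state (Suc t)))"
      using filled_verts pair_finite_verts finite_subset by (intro psubset_card_mono) blast+
    then show ?case using Suc by simp
  qed simp
  from this[of "Suc (card (pverts G))"] show False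
    using card_mono[OF pair_finite_verts filled_verts] by (metis not_less_eq_eq)
qed

end

section \<open>Stalled states: how far forcing penetrates a gap\<close>

locale stalled_process = transmission_process +
  fixes T :: nat
  assumes stalled: "filled (state (Suc T)) = filled (state T)" and alpha_le: "\<alpha> \<le> 1"
begin

text \<open>The filled sets at \<open>T\<close> and \<open>Suc T\<close> agree, but weights and
  forces are read at \<open>Suc T\<close>, after the vertices filled by time \<open>T\<close> could
  transmit.\<close>

abbreviation final :: "'a set" where
  "final \<equiv> filled (state (Suc T))"

abbreviation final_weight :: "'a \<Rightarrow> real" where
  "final_weight \<equiv> weight (state (Suc T))"

lemma unfilled_weight_less: "u \<in> pverts G \<Longrightarrow> u \<notin> final \<Longrightarrow> final_weight u < \<beta>"
  unfolding weight_Suc filled_Suc by (auto simp: unfilled_def not_le)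

text \<open>An unspent \<open>v\<close> transmits to \<open>u\<close> in the stationary step. A
  spent one forced some \<open>u'\<close> earlier; \<open>u\<close> was already an unfilled
  neighbour then, so \<open>u' = u\<close>.\<close>

lemma sole_unfilled_forced:
  assumes v: "v \<in> final" and u: "{x \<in> pverts G - final. (v, x) \<in> parcs G} = {u}"
  shows "(v, u) \<in> forces (Suc T)"
proof (cases "v \<in> spent (state T)")
  case False
  then have "v \<in> forcers G (state T) u" "u \<in> unfilled G (state T)"
    using v u unfolding forcers_def unfilled_def stalled by auto
  then show ?thesis by (simp add: forces_Suc)
next
  case True
  then obtain u' where vu': "(v, u') \<in> forces T" using spent_forces by blast
  then obtain s where s: "s < T" "{x \<in> unfilled G (state s). (v, x) \<in> parcs G} = {u'}"
    by (rule forcesE)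
  have "u \<in> unfilled G (state s)" "(v, u) \<in> parcs G"
    using u s(1) filled_mono[of s "Suc T"] unfolding unfilled_def by auto
  then have "u = u'" using s(2) by blast
  then show ?thesis using vu' by (simp add: forces_Suc)
qed

text \<open>The path enters a gap from the initial vertex \<open>p 0\<close>, and
  \<open>p (Suc k)\<close> is its first unfilled vertex. All forces on it run forward, so each step
  loses at most a factor \<open>\<alpha>\<close>.\<close>

lemma chain_reaches:
  fixes p :: "nat \<Rightarrow> 'a"
  assumes start: "p 0 \<in> B" "\<And>x. (p 0, x) \<in> parcs G \<Longrightarrow> x = p 1 \<or> x \<in> final"
    and nbrs: "\<And>i. 1 \<le> i \<Longrightarrow> i \<le> Suc k \<Longrightarrow> {x. (p i, x) \<in> parcs G} = {p (i - 1), p (i + 1)}"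
    and inner: "\<And>i. 1 \<le> i \<Longrightarrow> i \<le> k \<Longrightarrow> p i \<in> final - B"
    and stop: "p (Suc k) \<notin> final"
  shows "(p k, p (Suc k)) \<in> forces (Suc T)" and "\<alpha> ^ k \<le> final_weight (p k)"
proof -
  have fin: "p i \<in> final" if "i \<le> k" for i
    using inner[of i] start(1) B_filled[of "Suc T"] that by (cases "i = 0") auto
  have arc: "(p i, p (Suc i)) \<in> parcs G" if "i \<le> k" for i
    using nbrs[of "Suc i"] that arcs_symmetric by auto
  text \<open>
    Backwards from the stopping point: \<open>p (i + 1)\<close> forces \<open>p (i + 2)\<close>, so it can only have been
    filled by \<open>p i\<close>.
  \<close>
  have force: "(p (k - m), p (Suc (k - m))) \<in> forces (Suc T)" if "m \<le> k" for m
    using that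
  proof (induction m)
    case 0
    \<comment> \<open>The other neighbour of \<open>p k\<close> is filled: for \<open>k = 0\<close>
      by the assumption on the start, otherwise because it is \<open>p (k - 1)\<close>.\<close>
    have "x = p (Suc k)" if "x \<notin> final" "(p k, x) \<in> parcs G" for x
    proof (cases "k = 0")
      case True
      then show ?thesis using start(2) that by auto
    next
      case False
      then have "x = p (k - 1) \<or> x = p (Suc k)" using nbrs[of k] that by auto
      then show ?thesis using fin[of "k - 1"] that by auto
    qed
    then have "{x \<in> pverts G - final. (p k, x) \<in> parcs G} = {p (Suc k)}"
      using arc[of k] stop in_arcsD2 by blast
    then show ?case using sole_unfilled_forced fin by simp
  next
    case (Suc m)
    define i where "i = k - Suc m"
    have i: "k - m = Suc i" "Suc i \<le> k" using Suc.prems by (auto simp: i_def)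
    have next_force: "(p (Suc i), p (Suc (Suc i))) \<in> forces (Suc T)"
      using Suc i by simp
    obtain v where v: "(v, p (Suc i)) \<in> forces (Suc T)"
      using filled_forced[of "p (Suc i)" "Suc T"] inner[of "Suc i"] i by auto
    have "v \<in> {x. (p (Suc i), x) \<in> parcs G}" using forces_rev_arc[OF v] by simp
    also have "\<dots> = {p i, p (Suc (Suc i))}" using nbrs[of "Suc i"] i(2) by simp
    finally have "v = p i" using v forces_antisym[OF next_force] by auto
    then show ?case using v by (simp add: i_def)
  qed
  from force[of 0] show "(p k, p (Suc k)) \<in> forces (Suc T)" by simp
  have "\<alpha> ^ i \<le> final_weight (p i)" if "i \<le> k" for i
    using that
  proof (induction i)
    case 0
    then show ?case using weight_B[OF start(1)] by simp
  next
    case (Suc i)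
    have "(p i, p (Suc i)) \<in> forces (Suc T)" using force[of "k - i"] Suc.prems by simp
    then have "\<alpha> * final_weight (p i) \<le> final_weight (p (Suc i))"
      using sum_weight_le[of "{p i}"] by simp
    moreover have "\<alpha> * \<alpha> ^ i \<le> \<alpha> * final_weight (p i)"
      using Suc alpha_pos by (intro mult_left_mono) auto
    ultimately show ?case by simp
  qed
  then show "\<alpha> ^ k \<le> final_weight (p k)" by simp
qed

text \<open>The first unfilled vertex \<open>p m\<close> of the gap would receive at least
  \<open>\<alpha> ^ m\<close>, hence at least \<open>\<alpha> ^ g\<close>, and so reach the
  threshold.\<close>

lemma one_sided_gap:
  fixes p :: "nat \<Rightarrow> 'a"
  assumes start: "p 0 \<in> B" "\<And>x. (p 0, x) \<in> parcs G \<Longrightarrow> x = p 1 \<or> x \<in> final"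
    and nbrs: "\<And>i. 1 \<le> i \<Longrightarrow> i \<le> g \<Longrightarrow> {x. (p i, x) \<in> parcs G} = {p (i - 1), p (i + 1)}"
    and gap: "\<And>i. 1 \<le> i \<Longrightarrow> i \<le> g \<Longrightarrow> p i \<notin> B"
    and \<beta>: "\<beta> \<le> \<alpha> ^ g"
    and i: "i \<le> g"
  shows "p i \<in> final"
proof (rule ccontr)
  assume "p i \<notin> final"
  define m where "m = (LEAST i. p i \<notin> final)"
  have m: "p m \<notin> final" "m \<le> g" and less: "\<And>i. i < m \<Longrightarrow> p i \<in> final"
    using LeastI[of "\<lambda>i. p i \<notin> final", OF \<open>p i \<notin> final\<close>]
      Least_le[of "\<lambda>i. p i \<notin> final", OF \<open>p i \<notin> final\<close>] i not_less_Least
    unfolding m_def by (auto intro: le_trans)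
  obtain k where k: "m = Suc k"
    using m start(1) B_filled[of "Suc T"] by (cases m) auto
  have chain: "(p k, p (Suc k)) \<in> forces (Suc T)" "\<alpha> ^ k \<le> final_weight (p k)"
    using chain_reaches[of p k] start nbrs gap m less unfolding k by auto
  have V: "p (Suc k) \<in> pverts G" using forces_arc[OF chain(1)] by (rule in_arcsD2)
  have "\<alpha> * final_weight (p k) \<le> final_weight (p (Suc k))"
    using sum_weight_le[of "{p k}"] chain(1) by simp
  moreover have "\<alpha> * \<alpha> ^ k \<le> \<alpha> * final_weight (p k)"
    using chain alpha_pos by (intro mult_left_mono) auto
  moreover have "\<alpha> ^ g \<le> \<alpha> ^ Suc k"
    using m(2) k alpha_pos alpha_le by (intro power_decreasing) auto
  ultimately show False using \<beta> unfilled_weight_less[OF V] m(1) k by simp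
qed

text \<open>Otherwise let \<open>Suc k\<close> and \<open>g - k'\<close> be the first and last
  unfilled positions. Both \<open>k\<close> and \<open>k'\<close> are at least \<open>J - 1\<close>,
  so \<open>g\<close> is at least \<open>2 * J - 1\<close>. Only the second alternative of
  \<open>len\<close> permits this, with equality; then both sides force the same vertex, whose
  weight reaches \<open>2 * \<alpha> ^ J\<close>.\<close>

lemma two_sided_gap:
  fixes p :: "nat \<Rightarrow> 'a"
  assumes start: "p 0 \<in> B" "\<And>x. (p 0, x) \<in> parcs G \<Longrightarrow> x = p 1 \<or> x \<in> final"
    and stop: "p (Suc g) \<in> B" "\<And>x. (p (Suc g), x) \<in> parcs G \<Longrightarrow> x = p g \<or> x \<in> final"
    and nbrs: "\<And>i. 1 \<le> i \<Longrightarrow> i \<le> g \<Longrightarrow> {x. (p i, x) \<in> parcs G} = {p (i - 1), p (i + 1)}"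
    and distinct: "\<And>i. 1 \<le> i \<Longrightarrow> i \<le> g \<Longrightarrow> p (i - 1) \<noteq> p (i + 1)"
    and gap: "\<And>i. 1 \<le> i \<Longrightarrow> i \<le> g \<Longrightarrow> p i \<notin> B"
    and \<beta>: "\<beta> \<le> \<alpha> ^ (J - 1)"
    and len: "g + 2 \<le> 2 * J \<or> g + 1 \<le> 2 * J \<and> \<beta> \<le> 2 * \<alpha> ^ J"
    and i: "i \<le> Suc g"
  shows "p i \<in> final"
proof (rule ccontr)
  assume "p i \<notin> final"
  define U where "U = {i. i \<le> Suc g \<and> p i \<notin> final}"
  have U: "finite U" "U \<noteq> {}" using \<open>p i \<notin> final\<close> i by (auto simp: U_def)
  have inU: "Min U \<in> U" "Max U \<in> U" using U Min_in Max_in by blast+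
  have ends: "0 \<notin> U" "Suc g \<notin> U" using start(1) stop(1) B_filled[of "Suc T"] by (auto simp: U_def)
  obtain k where k: "Min U = Suc k" using inU(1) ends(1) by (cases "Min U") auto
  have U_D: "i \<le> Suc g" "p i \<notin> final" if "i \<in> U" for i using that by (simp_all add: U_def)
  have U_I: "p i \<in> final" if "i \<le> Suc g" "i \<notin> U" for i using that by (simp add: U_def)
  have "Max U \<noteq> Suc g" using inU(2) ends(2) by metis
  then have Max_le: "Max U \<le> g" using U_D(1)[OF inU(2)] by simp
  have "0 < Max U" using inU(2) ends(1) by (metis neq0_conv)
  define k' where "k' = g - Max U"
  have k': "Max U = g - k'" "k' < g" "Suc g - Suc k' = Max U"
    using Max_le \<open>0 < Max U\<close> by (auto simp: k'_def)
  have le: "Suc k \<le> g - k'" using Min_le[OF U(1) inU(2)] k k' by simp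
  have below: "p i \<in> final" if "i \<le> k" for i
    using that Min_le[OF U(1), of i] k le k'(1) Max_le by (intro U_I) auto
  have above: "p i \<in> final" if "g - k' < i" "i \<le> Suc g" for i
    using that Max_ge[OF U(1), of i] k'(1) by (intro U_I) auto
  have chain: "(p k, p (Suc k)) \<in> forces (Suc T)" "\<alpha> ^ k \<le> final_weight (p k)"
    using chain_reaches[of p k] start nbrs gap le below U_D(2)[OF inU(1)] unfolding k by auto
  \<comment> \<open>The reversed path, so that \<open>chain_reaches\<close> also applies from the
    far end.\<close>
  define q where "q i = p (Suc g - i)" for i
  have q_nbrs: "{x. (q i, x) \<in> parcs G} = {q (i - 1), q (i + 1)}" if "1 \<le> i" "i \<le> Suc k'" for i
    using nbrs[of "Suc g - i"] that k' by (auto simp: q_def Suc_diff_le insert_commute)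
  have chain': "(q k', q (Suc k')) \<in> forces (Suc T)" "\<alpha> ^ k' \<le> final_weight (q k')"
    using chain_reaches[of q k', OF _ _ q_nbrs] stop gap k' above U_D(2)[OF inU(2)]
    by (auto simp: q_def)
  \<comment> \<open>A transmission of \<open>\<alpha> ^ Suc d\<close> with \<open>Suc d < J\<close>
    would already reach the threshold.\<close>
  have long: "J \<le> Suc d"
    if "(x, y) \<in> forces (Suc T)" "\<alpha> ^ d \<le> final_weight x" "y \<notin> final" for x y d
  proof (rule ccontr)
    assume "\<not> J \<le> Suc d"
    then have "\<alpha> ^ (J - 1) \<le> \<alpha> ^ Suc d"
      using alpha_pos alpha_le by (intro power_decreasing) auto
    moreover have "\<alpha> * \<alpha> ^ d \<le> \<alpha> * final_weight x"
      using that alpha_pos by (intro mult_left_mono) auto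
    moreover have "\<alpha> * final_weight x \<le> final_weight y"
      using sum_weight_le[of "{x}"] that(1) by simp
    moreover have "final_weight y < \<beta>"
      using forces_arc[OF that(1)] in_arcsD2 unfilled_weight_less that(3) by blast
    ultimately show False using \<beta> by simp
  qed
  have J: "J \<le> Suc k" "J \<le> Suc k'"
    using long[OF chain] long[OF chain'] U_D(2)[OF inU(1)] U_D(2)[OF inU(2)] k k'(3) by (simp_all add: q_def)
  have g: "g + 1 \<le> 2 * J" "g + 2 \<le> 2 * J \<Longrightarrow> False" using len J le by auto
  then have eq: "J = Suc k" "k' = k" "g - k' = Suc k" using J le by auto
  have "q k' = p (Suc (Suc k))" "q (Suc k') = p (Suc k)"
    using eq k' by (auto simp: q_def Suc_diff_le)
  then have ch2: "(p (Suc (Suc k)), p (Suc k)) \<in> forces (Suc T)"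
      "\<alpha> ^ k \<le> final_weight (p (Suc (Suc k)))"
    using chain' eq by auto
  have "p k \<noteq> p (Suc (Suc k))" using distinct[of "Suc k"] le by simp
  then have "\<alpha> * final_weight (p k) + \<alpha> * final_weight (p (Suc (Suc k))) \<le> final_weight (p (Suc k))"
    using sum_weight_le[of "{p k, p (Suc (Suc k))}"] chain(1) ch2(1) by simp
  moreover have "\<alpha> * \<alpha> ^ k \<le> \<alpha> * final_weight (p k)" "\<alpha> * \<alpha> ^ k \<le> \<alpha> * final_weight (p (Suc (Suc k)))"
    using chain(2) ch2(2) alpha_pos by (intro mult_left_mono; simp)+
  moreover have "final_weight (p (Suc k)) < \<beta>"
    using forces_arc[OF chain(1)] in_arcsD2 unfilled_weight_less U_D(2)[OF inU(1)] k by (metis (no_types))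
  moreover have "\<beta> \<le> 2 * \<alpha> ^ J" using len g by blast
  ultimately show False using eq(1) by simp
qed

end

section \<open>Gaps on the cycle, with vertices written as residues of unreduced positions\<close>

lemma cycle_graph_nbrs:
  assumes "n \<ge> 3" "x \<ge> 1"
  shows "{y. (x mod n, y) \<in> parcs (cycle_graph n)} = {(x - 1) mod n, (x + 1) mod n}"
proof -
  obtain z where z: "x = Suc z" using assms by (cases x) auto
  have "(Suc z mod n = Suc y mod n) = (y = z mod n)" if "y < n" for y
  proof
    assume "Suc z mod n = Suc y mod n"
    then have "(Suc z + (n - 1)) mod n = (Suc y + (n - 1)) mod n" by (metis mod_add_left_eq)
    then show "y = z mod n" using assms that by simp
  next
    assume "y = z mod n"
    then show "Suc z mod n = Suc y mod n" by (simp add: mod_Suc_eq)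
  qed
  then show ?thesis
    using assms unfolding z by (auto simp: cycle_graph_def mod_Suc_eq)
qed

lemma cycle_graph_degree: "n \<ge> 3 \<Longrightarrow> card {y. (x, y) \<in> parcs (cycle_graph n)} \<le> 2"
proof (cases "x < n")
  case True
  moreover assume "n \<ge> 3"
  ultimately show ?thesis using cycle_graph_nbrs[of n "x + n"] by (simp add: card_insert_if)
next
  case False
  then have "{y. (x, y) \<in> parcs (cycle_graph n)} = {}" by (auto simp: cycle_graph_def)
  then show ?thesis by (metis card.empty le0)
qed

locale stalled_cycle = stalled_process "cycle_graph n" for n +
  assumes n: "3 \<le> n"
begin

text \<open>The path runs downwards from the initial vertex at \<open>b\<close>, whose upper
  neighbour is already filled, through the \<open>b - a - 1\<close> positions above
  \<open>a\<close>.\<close>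

lemma cycle_one_sided_gap:
  assumes ends: "b mod n \<in> B" "Suc b mod n \<in> final"
    and gap: "\<And>y. a < y \<Longrightarrow> y < b \<Longrightarrow> y mod n \<notin> B"
    and \<beta>: "\<beta> \<le> \<alpha> ^ (b - a - 1)"
    and x: "a < x" "x \<le> b"
  shows "x mod n \<in> final"
proof -
  define p where "p i = (b - i) mod n" for i
  have nbrs: "{y. (p i, y) \<in> parcs (cycle_graph n)} = {(b - i - 1) mod n, (b - i + 1) mod n}"
    if "i < b" for i
    using cycle_graph_nbrs[OF n, of "b - i"] that by (simp add: p_def)
  have "p (b - x) \<in> final"
  proof (rule one_sided_gap[of p "b - a - 1"])
    show "y = p 1 \<or> y \<in> final" if "(p 0, y) \<in> parcs (cycle_graph n)" for y
      using nbrs[of 0] that ends x by (auto simp: p_def)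
    show "{y. (p i, y) \<in> parcs (cycle_graph n)} = {p (i - 1), p (i + 1)}"
      if "1 \<le> i" "i \<le> b - a - 1" for i
      using nbrs[of i] that x by (auto simp: p_def Suc_diff_le)
    show "p i \<notin> B" if "1 \<le> i" "i \<le> b - a - 1" for i
      using gap[of "b - i"] that by (auto simp: p_def)
  qed (use ends \<beta> x in \<open>auto simp: p_def\<close>)
  then show ?thesis using x by (simp add: p_def)
qed

text \<open>The gap between \<open>a\<close> and \<open>b\<close> has \<open>g = b - a - 1\<close>
  positions, which turns \<open>len\<close> into the bounds of \<open>two_sided_gap\<close>. The
  outer neighbours of both ends are filled, so only the inner ones can be missing.\<close>

lemma cycle_two_sided_gap:
  assumes "1 \<le> a" and ends: "a mod n \<in> B" "(a - 1) mod n \<in> final" "b mod n \<in> B" "Suc b mod n \<in> final"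
    and gap: "\<And>y. a < y \<Longrightarrow> y < b \<Longrightarrow> y mod n \<notin> B"
    and \<beta>: "\<beta> \<le> \<alpha> ^ (J - 1)"
    and len: "b - a + 1 \<le> 2 * J \<or> b - a \<le> 2 * J \<and> \<beta> \<le> 2 * \<alpha> ^ J"
    and x: "a < x" "x < b"
  shows "x mod n \<in> final"
proof -
  define p where "p i = (a + i) mod n" for i
  have nbrs: "{y. (p i, y) \<in> parcs (cycle_graph n)} = {(a + i - 1) mod n, (a + i + 1) mod n}" for i
    using cycle_graph_nbrs[OF n, of "a + i"] assms(1) by (simp add: p_def)
  have "p (x - a) \<in> final"
  proof (rule two_sided_gap[of p "b - a - 1" J])
    show "y = p 1 \<or> y \<in> final" if "(p 0, y) \<in> parcs (cycle_graph n)" for y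
    proof -
      have "y \<in> {(a - 1) mod n, (a + 1) mod n}" using that nbrs[of 0] by auto
      then show ?thesis using ends by (auto simp: p_def)
    qed
    show "y = p (b - a - 1) \<or> y \<in> final"
      if "(p (Suc (b - a - 1)), y) \<in> parcs (cycle_graph n)" for y
    proof -
      have "y \<in> {(b - 1) mod n, Suc b mod n}" using that nbrs[of "Suc (b - a - 1)"] x by auto
      then show ?thesis using ends x by (auto simp: p_def)
    qed
    show "{y. (p i, y) \<in> parcs (cycle_graph n)} = {p (i - 1), p (i + 1)}" if "1 \<le> i" for i
      using nbrs[of i] that by (simp add: p_def)
    \<comment> \<open>Positions two apart agree modulo \<open>n\<close> only if \<open>n\<close>
      divides 2.\<close>
    show "p (i - 1) \<noteq> p (i + 1)" if "1 \<le> i" for i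
    proof
      assume "p (i - 1) = p (i + 1)"
      then have "n dvd (a + (i + 1)) - (a + (i - 1))"
        unfolding p_def by (subst mod_eq_dvd_iff_nat[symmetric]) auto
      moreover have "(a + (i + 1)) - (a + (i - 1)) = 2" using that by simp
      ultimately show False using n by (auto dest: dvd_imp_le)
    qed
    show "p i \<notin> B" if "1 \<le> i" "i \<le> b - a - 1" for i
      using gap[of "a + i"] that by (auto simp: p_def)
  qed (use ends \<beta> x len in \<open>auto simp: p_def\<close>)
  then show ?thesis using x by (simp add: p_def)
qed

text \<open>The positions below \<open>e\<close> are cut into blocks of length \<open>c\<close>,
  each opening with a pair of initial vertices that shield each other's outer side. At most
  \<open>c - 2\<close> positions remain before the next pair or the cut-off \<open>e\<close>, which
  is within reach of \<open>cycle_two_sided_gap\<close>.\<close>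

lemma cycle_pairs_filled:
  assumes "2 \<le> c" and \<beta>: "\<beta> \<le> \<alpha> ^ (J - 1)"
    and c: "c = 2 * J \<or> c = 2 * J + 1 \<and> \<beta> \<le> 2 * \<alpha> ^ J"
    and pairs: "\<And>i. i < m \<Longrightarrow> (i * c) mod n \<in> B" "\<And>i. i < m \<Longrightarrow> Suc (i * c) mod n \<in> B"
    and e: "e \<le> m * c" "e \<le> n" "e mod n \<in> B" "Suc e mod n \<in> final"
    and gap: "\<And>y. y < e \<Longrightarrow> y \<in> B \<Longrightarrow> y mod c \<le> 1"
    and x: "x < e"
  shows "x \<in> final"
proof -
  define i r where "i = x div c" and "r = x mod c"
  have xr: "x = i * c + r" "r < c" using assms(1) by (auto simp: i_def r_def)
  have "i * c < m * c" using xr x e(1) by linarith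
  then have i: "i < m" by simp
  have xn: "x mod n = x" using x e(2) by simp
  have B: "B \<subseteq> final" by (rule B_filled)
  consider "r = 0" | "r = 1" | "2 \<le> r" by linarith
  then show ?thesis
  proof cases
    case 3
    define b where "b = min (Suc i * c) e"
    have b_le: "b \<le> Suc i * c" "b \<le> e" by (simp_all add: b_def)
    have "x < Suc i * c" using xr by simp
    then have x_less: "x < b" using x by (simp add: b_def)
    have b: "b mod n \<in> B \<and> Suc b mod n \<in> final"
    proof (cases "Suc i * c < e")
      case True
      have "Suc i * c < m * c" using True e(1) by linarith
      then have "Suc i < m" by (simp only: mult_less_cancel2)
      moreover have "b = Suc i * c" using True by (simp add: b_def)
      ultimately show ?thesis using pairs[of "Suc i"] B by blast
    next
      case False
      then have "b = e" by (simp add: b_def)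
      then show ?thesis using e(3,4) by simp
    qed
    \<comment> \<open>Inside the gap the residue modulo \<open>c\<close> is at least 2, so
      \<open>gap\<close> excludes initial vertices.\<close>
    have no_B: "y mod n \<notin> B" if "Suc (i * c) < y" "y < b" for y
    proof
      assume "y mod n \<in> B"
      moreover have "y < e" "y < Suc i * c" using that(2) b_le by linarith+
      ultimately have "y mod c \<le> 1" using gap e(2) by simp
      moreover have "y mod c = y - i * c"
        using that \<open>y < Suc i * c\<close> by (intro mod_nat_eqI) auto
      ultimately show False using that by linarith
    qed
    have "b - Suc (i * c) + 1 \<le> c" using assms(1) b_le(1) by simp
    then have len: "b - Suc (i * c) + 1 \<le> 2 * J \<or> b - Suc (i * c) \<le> 2 * J \<and> \<beta> \<le> 2 * \<alpha> ^ J"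
      using c by linarith
    have "1 \<le> Suc (i * c)" "(Suc (i * c) - 1) mod n \<in> final" "Suc (i * c) < x"
      using pairs(1)[OF i] B 3 xr(1) by auto
    then have "x mod n \<in> final"
      using cycle_two_sided_gap[OF _ pairs(2)[OF i] _ conjunct1[OF b] conjunct2[OF b] no_B \<beta> len _ x_less]
      by blast
    then show ?thesis using xn by simp
  qed (use pairs[OF i] B xn xr in auto)
qed

end

section \<open>Initial sets of periodically placed adjacent pairs\<close>

definition block_pairs :: "nat \<Rightarrow> nat \<Rightarrow> nat set" where
  "block_pairs c m = (\<lambda>i. i * c) ` {..<m} \<union> (\<lambda>i. Suc (i * c)) ` {..<m}"

lemma block_pairs_mod: "2 \<le> c \<Longrightarrow> y \<in> block_pairs c m \<Longrightarrow> y mod c \<le> 1"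
  by (auto simp: block_pairs_def mod_Suc)

lemma block_pairs_less: "2 \<le> c \<Longrightarrow> y \<in> block_pairs c m \<Longrightarrow> y < m * c"
proof -
  assume c: "2 \<le> c" and "y \<in> block_pairs c m"
  then obtain i where i: "i < m" "y \<le> Suc (i * c)" by (auto simp: block_pairs_def)
  have "Suc i * c \<le> m * c" using i(1) by (intro mult_le_mono1) simp
  then show ?thesis using i(2) c by simp
qed

text \<open>This bound keeps the set inside a cycle that ends right after the last pair.\<close>

lemma block_pairs_le:
  assumes "y \<in> block_pairs c m"
  shows "y \<le> Suc ((m - 1) * c)"
proof -
  obtain i where i: "i < m" "y \<le> Suc (i * c)" using assms by (auto simp: block_pairs_def)
  have "i * c \<le> (m - 1) * c" using i(1) by (intro mult_le_mono1) simp
  then show ?thesis using i(2) by linarith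
qed

lemma finite_block_pairs: "finite (block_pairs c m)"
  by (simp add: block_pairs_def)

lemma card_block_pairs:
  assumes "2 \<le> c"
  shows "card (block_pairs c m) = 2 * m"
proof -
  have "Suc (k * c) mod c = 1" "i * c mod c = 0" for i k using assms by (simp_all add: mod_Suc)
  then have "i * c \<noteq> Suc (k * c)" for i k by (metis zero_neq_one)
  then have "card (block_pairs c m) =
      card ((\<lambda>i. i * c) ` {..<m}) + card ((\<lambda>i. Suc (i * c)) ` {..<m})"
    unfolding block_pairs_def by (intro card_Un_disjoint) auto
  also have "\<dots> = m + m"
    using assms by (subst (1 2) card_image) (auto simp: inj_on_def)
  finally show ?thesis by simp
qed

section \<open>Forcing sets of the cycle: lower bounds and constructions\<close>

context
  fixes \<alpha> \<beta> :: real and n J :: nat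
  assumes \<alpha>: "0 < \<alpha>" "\<alpha> \<le> 1" and \<beta>: "0 < \<beta>" and n: "3 \<le> n"
begin

lemma cycle_process: "B \<subseteq> {..<n} \<Longrightarrow> transmission_process (cycle_graph n) \<alpha> \<beta> B"
  using \<alpha> \<beta>
  by (intro transmission_process.intro transmission_process_axioms.intro pair_graph_cycle_graph[OF n])
    (simp_all add: cycle_graph_def)

text \<open>By \<open>ex_stalled\<close> a stationary step always occurs, so it suffices to inspect
  a stalled state, and no filling times have to be computed.\<close>

lemma cycle_forcing_setI:
  assumes B: "B \<subseteq> {..<n}"
    and step: "\<And>T. stalled_cycle \<alpha> \<beta> B T n \<Longrightarrow> {..<n} \<subseteq> filled (tf_process \<alpha> \<beta> (cycle_graph n) B (Suc T))"
  shows "transmission_zero_forcing_set \<alpha> \<beta> (cycle_graph n) B"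
proof -
  interpret transmission_process "cycle_graph n" \<alpha> \<beta> B using cycle_process[OF B] .
  obtain T where T: "filled (state (Suc T)) = filled (state T)" using ex_stalled by blast
  interpret stalled_cycle \<alpha> \<beta> B T n using T \<alpha> n by unfold_locales auto
  have "{..<n} \<subseteq> filled (state (Suc T))" by (rule step) unfold_locales
  then have "filled (state (Suc T)) = pverts (cycle_graph n)"
    using filled_verts[of "Suc T"] by (auto simp: cycle_graph_def)
  then show ?thesis using B_subset unfolding transmission_zero_forcing_set_def by blast
qed

lemma cycle_forcing_card:
  assumes B: "transmission_zero_forcing_set \<alpha> \<beta> (cycle_graph n) B" and J: "\<alpha> ^ J < \<beta>" "\<beta> \<le> 1"
  shows "2 * n \<le> (2 * J + 1) * card B" and "2 * \<alpha> ^ J < \<beta> \<Longrightarrow> n \<le> J * card B"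
proof -
  have "B \<subseteq> {..<n}"
    using B by (simp add: transmission_zero_forcing_set_def cycle_graph_def)
  then interpret transmission_process "cycle_graph n" \<alpha> \<beta> B by (rule cycle_process)
  obtain T where T: "filled (state T) = pverts (cycle_graph n)"
    using B unfolding transmission_zero_forcing_set_def by blast
  have V: "card (pverts (cycle_graph n)) = n" by (simp add: cycle_graph_def)
  show "2 * n \<le> (2 * J + 1) * card B"
    using card_verts_le[OF T cycle_graph_degree[OF n] \<alpha>(2) J] V by simp
  show "n \<le> J * card B" if "2 * \<alpha> ^ J < \<beta>"
    using card_verts_le_strong[OF T cycle_graph_degree[OF n] \<alpha>(2) J that] V by simp
qed

text \<open>A single initial vertex has two distinct unfilled neighbours and never forces, and
  without a force nothing is filled. The filled set thus stays equal to \<open>B\<close>.\<close>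

lemma cycle_forcing_card_ge_2:
  assumes B: "transmission_zero_forcing_set \<alpha> \<beta> (cycle_graph n) B"
  shows "2 \<le> card B"
proof (rule ccontr)
  assume small: "\<not> 2 \<le> card B"
  have Bn: "B \<subseteq> {..<n}"
    using B by (simp add: transmission_zero_forcing_set_def cycle_graph_def)
  then interpret transmission_process "cycle_graph n" \<alpha> \<beta> B by (rule cycle_process)
  obtain T where T: "filled (state T) = pverts (cycle_graph n)"
    using B unfolding transmission_zero_forcing_set_def by blast
  have "filled (state t) = B" for t
  proof (induction t)
    case (Suc t)
    have "u \<in> B" if u: "u \<in> filled (state (Suc t))" for u
    proof (rule ccontr)
      assume "u \<notin> B"
      then obtain v where "(v, u) \<in> forces (Suc t)" using filled_forced u by blast
      then obtain s where s: "s < Suc t" "v \<in> filled (state s)"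
        "{x \<in> unfilled (cycle_graph n) (state s). (v, x) \<in> parcs (cycle_graph n)} = {u}"
        by (rule forcesE)
      then have "v \<in> B" using Suc filled_mono[of s t] by auto
      then have "B = {v}" using small finite_B card_le_Suc0_iff_eq[of B] by auto
      then have "filled (state s) = {v}" using Suc s(1) filled_mono[of s t] B_filled[of s] by auto
      then have "{x \<in> pverts (cycle_graph n). x \<noteq> v \<and> (v, x) \<in> parcs (cycle_graph n)} = {u}"
        using s(3) by (auto simp: unfilled_def)
      also have "{x \<in> pverts (cycle_graph n). x \<noteq> v \<and> (v, x) \<in> parcs (cycle_graph n)} =
          {x. (v, x) \<in> parcs (cycle_graph n)}"
        using in_arcsD2 pair_no_loops by fastforce
      also have "\<dots> = {(v + n - 1) mod n, (v + n + 1) mod n}"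
        using cycle_graph_nbrs[OF n, of "v + n"] \<open>v \<in> B\<close> Bn n by (simp add: subset_iff)
      finally have "(v + n - 1) mod n = (v + n + 1) mod n" by auto
      then have "n dvd (v + n + 1) - (v + n - 1)"
        by (subst mod_eq_dvd_iff_nat[symmetric]) auto
      moreover have "(v + n + 1) - (v + n - 1) = 2" using n by simp
      ultimately show False using n by (auto dest: dvd_imp_le)
    qed
    then show ?case using B_filled by blast
  qed (simp add: tf_init_def)
  then have "B = {..<n}" using T by (simp add: cycle_graph_def)
  then show False using small n by simp
qed

context
  fixes c m :: nat
  assumes \<beta>_le: "\<beta> \<le> \<alpha> ^ (J - 1)"
    and c: "2 \<le> c" "c = 2 * J \<or> c = 2 * J + 1 \<and> \<beta> \<le> 2 * \<alpha> ^ J" and m: "1 \<le> m"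
begin

text \<open>Position \<open>n\<close> wraps to 0, so the first pair also closes the last block,
  which may be truncated but still contains its own pair.\<close>

lemma block_pairs_forcing:
  assumes "(m - 1) * c + 2 \<le> n" "n \<le> m * c"
  shows "transmission_zero_forcing_set \<alpha> \<beta> (cycle_graph n) (block_pairs c m)"
proof (rule cycle_forcing_setI)
  show less: "block_pairs c m \<subseteq> {..<n}" using block_pairs_le assms(1) by fastforce
  fix T assume "stalled_cycle \<alpha> \<beta> (block_pairs c m) T n"
  then interpret stalled_cycle \<alpha> \<beta> "block_pairs c m" T n .
  have in_pairs: "i * c \<in> block_pairs c m" "Suc (i * c) \<in> block_pairs c m" if "i < m" for i
    using that by (auto simp: block_pairs_def)
  have lt: "i * c < n" "Suc (i * c) < n" if "i < m" for i
    using in_pairs[OF that] less by auto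
  show "{..<n} \<subseteq> final"
  proof
    fix x assume "x \<in> {..<n}"
    show "x \<in> final"
    proof (rule cycle_pairs_filled[OF c(1) \<beta>_le c(2), of m n])
      show "n mod n \<in> block_pairs c m" "Suc n mod n \<in> final"
        using in_pairs[of 0] m n B_filled[of "Suc T"] by (auto simp: mod_Suc)
      show "y mod c \<le> 1" if "y \<in> block_pairs c m" for y
        using block_pairs_mod[OF c(1) that] .
    qed (use in_pairs lt assms(2) \<open>x \<in> {..<n}\<close> in auto)
  qed
qed

text \<open>A remainder of at most \<open>J\<close> positions after the full blocks costs only one
  extra initial vertex, at \<open>m * c\<close>.\<close>

lemma insert_block_pairs_forcing:
  assumes "m * c < n" "n \<le> m * c + J"
  shows "transmission_zero_forcing_set \<alpha> \<beta> (cycle_graph n) (insert (m * c) (block_pairs c m))"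
    (is "transmission_zero_forcing_set _ _ _ ?B")
proof (rule cycle_forcing_setI)
  show less: "?B \<subseteq> {..<n}" using block_pairs_less[OF c(1)] assms(1) by fastforce
  fix T assume "stalled_cycle \<alpha> \<beta> ?B T n"
  then interpret stalled_cycle \<alpha> \<beta> ?B T n .
  have in_pairs: "i * c \<in> ?B" "Suc (i * c) \<in> ?B" if "i < m" for i
    using that by (auto simp: block_pairs_def)
  have lt: "i * c < n" "Suc (i * c) < n" if "i < m" for i
    using in_pairs[OF that] less by auto
  have BF: "?B \<subseteq> final" by (rule B_filled)
  have zero: "0 \<in> ?B" "Suc 0 \<in> ?B" using in_pairs[of 0] m by auto
  \<comment> \<open>The at most \<open>J - 1\<close> positions beyond \<open>m * c\<close> are
    filled backwards from the pair at 0 and 1. This gives \<open>m * c\<close> a filled upper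
    neighbour, so that it can close the last full block.\<close>
  have tail: "x mod n \<in> final" if "m * c < x" "x \<le> n" for x
  proof (rule cycle_one_sided_gap[of n "m * c"])
    show "\<beta> \<le> \<alpha> ^ (n - m * c - 1)"
      using \<beta>_le assms \<alpha> power_decreasing[of "n - m * c - 1" "J - 1" \<alpha>] by linarith
    show "y mod n \<notin> ?B" if "m * c < y" "y < n" for y
      using that block_pairs_less[OF c(1), of y m] by auto
  qed (use that zero BF n in \<open>auto simp: mod_Suc\<close>)
  show "{..<n} \<subseteq> final"
  proof
    fix x assume x: "x \<in> {..<n}"
    consider "x < m * c" | "x = m * c" | "m * c < x" by linarith
    then show "x \<in> final"
    proof cases
      case 1
      have "Suc (m * c) mod n \<in> final" using tail[of "Suc (m * c)"] assms by simp
      show ?thesis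
      proof (rule cycle_pairs_filled[OF c(1) \<beta>_le c(2), of m "m * c"])
        show "Suc (m * c) mod n \<in> final" by fact
        show "y mod c \<le> 1" if "y < m * c" "y \<in> ?B" for y
          using block_pairs_mod[OF c(1), of y m] that by auto
      qed (use in_pairs lt assms(1) 1 in auto)
    qed (use BF tail[of x] x in auto)
  qed
qed

end

text \<open>The remainder \<open>r\<close> selects the set: full blocks for \<open>r = 0\<close>, an
  extra vertex for \<open>r \<le> J\<close>, a truncated further block for \<open>r > J\<close>. The
  sizes \<open>2 * q\<close>, \<open>2 * q + 1\<close> and \<open>2 * q + 2\<close> stay below
  \<open>2 * n / c + 1\<close>, in the last case because \<open>2 * r\<close> exceeds
  \<open>c\<close>.\<close>

lemma ex_small_cycle_forcing_set:
  assumes \<beta>_le: "\<beta> \<le> \<alpha> ^ (J - 1)" and J: "1 \<le> J" "J < n"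
    and c: "c = 2 * J \<or> c = 2 * J + 1 \<and> \<beta> \<le> 2 * \<alpha> ^ J"
  shows "\<exists>B. transmission_zero_forcing_set \<alpha> \<beta> (cycle_graph n) B \<and> c * card B < 2 * n + c"
proof -
  define q r where "q = n div c" and "r = n mod c"
  have c2: "2 \<le> c" using c J by auto
  have nqr: "n = q * c + r" "r < c" using c2 by (auto simp: q_def r_def)
  consider "r = 0" | "1 \<le> r" "r \<le> J" | "J < r" by linarith
  then show ?thesis
  proof cases
    case 1
    then have "1 \<le> q" using nqr n by (cases q) auto
    then have "(q - 1) * c + 2 \<le> n" using 1 nqr c2 by (cases q) auto
    with block_pairs_forcing[OF \<beta>_le c2 c \<open>1 \<le> q\<close>] 1 nqr c2 show ?thesis
      by (intro exI[of _ "block_pairs c q"]) (simp add: card_block_pairs)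
  next
    case 2
    then have "1 \<le> q" using nqr J by (cases q) auto
    have "q * c \<notin> block_pairs c q" using block_pairs_less[OF c2] by blast
    then have "card (insert (q * c) (block_pairs c q)) = 2 * q + 1"
      by (simp add: finite_block_pairs card_block_pairs[OF c2])
    moreover have "c * (2 * q + 1) < 2 * n + c" using 2 nqr by (simp add: algebra_simps)
    ultimately show ?thesis
      using insert_block_pairs_forcing[OF \<beta>_le c2 c \<open>1 \<le> q\<close>] 2 nqr
      by (intro exI[of _ "insert (q * c) (block_pairs c q)"]) simp
  next
    case 3
    \<comment> \<open>Here \<open>r\<close> is at least 2, so the pair of the truncated block
      fits.\<close>
    have "transmission_zero_forcing_set \<alpha> \<beta> (cycle_graph n) (block_pairs c (Suc q))"
      using 3 nqr J by (intro block_pairs_forcing[OF \<beta>_le c2 c]) auto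
    moreover have "c * (2 * Suc q) < 2 * n + c"
      using 3 nqr c by (auto simp: algebra_simps)
    ultimately show ?thesis
      by (intro exI[of _ "block_pairs c (Suc q)"]) (simp only: card_block_pairs[OF c2])
  qed
qed

end

section \<open>From size bounds to the forcing numbers\<close>

lemma transmission_zero_forcing_number_eqI:
  assumes "transmission_zero_forcing_set \<alpha> \<beta> G B" "card B \<le> k"
    and "\<And>B. transmission_zero_forcing_set \<alpha> \<beta> G B \<Longrightarrow> k \<le> card B"
  shows "transmission_zero_forcing_number \<alpha> \<beta> G = k"
  unfolding transmission_zero_forcing_number_def
proof (rule Least_equality)
  show "\<exists>B. transmission_zero_forcing_set \<alpha> \<beta> G B \<and> card B = k"
    using assms(1,2) assms(3)[OF assms(1)] le_antisym by blast
qed (use assms(3) in blast)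

text \<open>The strict upper bound for \<open>B\<close> and the lower bound for all forcing sets
  leave none smaller than \<open>B\<close>; the same inequalities make \<open>card B\<close> the
  ceiling. Both periods, \<open>2 * J\<close> and \<open>2 * J + 1\<close>, are covered.\<close>

lemma cycle_forcing_number_ceiling:
  fixes \<alpha> \<beta> :: real
  assumes "0 < c" "transmission_zero_forcing_set \<alpha> \<beta> (cycle_graph n) B" "c * card B < 2 * n + c"
    and lower: "\<And>B. transmission_zero_forcing_set \<alpha> \<beta> (cycle_graph n) B \<Longrightarrow> 2 * n \<le> c * card B"
  shows "int (transmission_zero_forcing_number \<alpha> \<beta> (cycle_graph n)) = \<lceil>2 * real n / real c\<rceil>"
proof -
  have "card B \<le> card B'" if "transmission_zero_forcing_set \<alpha> \<beta> (cycle_graph n) B'" for B'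
  proof -
    have "c * card B < c * Suc (card B')" using assms(3) lower[OF that] by simp
    then show ?thesis by (simp only: mult_less_cancel1 less_Suc_eq_le)
  qed
  then have num: "transmission_zero_forcing_number \<alpha> \<beta> (cycle_graph n) = card B"
    using assms(2) by (intro transmission_zero_forcing_number_eqI) auto
  have "real (2 * n) \<le> real (c * card B)" "real (c * card B) < real (2 * n + c)"
    using lower[OF assms(2)] assms(3) by (simp_all only: of_nat_le_iff of_nat_less_iff)
  then have "\<lceil>2 * real n / real c\<rceil> = int (card B)"
    using assms(1) by (intro ceiling_unique) (simp_all add: field_simps)
  then show ?thesis using num by simp
qed

theorem theorem4p2p2:
  fixes \<alpha> \<beta> :: real and j :: int and n :: nat
  assumes "0 < \<alpha>" and "\<alpha> < 1"
    and "0 \<le> \<beta>" and "\<beta> \<le> 1"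
    and "\<alpha> powi j < \<beta>" and "\<beta> \<le> \<alpha> powi (j - 1)"
    and "n \<ge> 3"
  shows "(int n > j \<and> 2 * \<alpha> powi j < \<beta> \<longrightarrow>
           int (transmission_zero_forcing_number \<alpha> \<beta> (cycle_graph n)) =
             \<lceil>real n / real_of_int j\<rceil>) \<and>
         (int n > j \<and> \<beta> \<le> 2 * \<alpha> powi j \<longrightarrow>
           int (transmission_zero_forcing_number \<alpha> \<beta> (cycle_graph n)) =
             \<lceil>2 * real n / (2 * real_of_int j + 1)\<rceil>) \<and>
         (int n \<le> j \<longrightarrow>
           transmission_zero_forcing_number \<alpha> \<beta> (cycle_graph n) = 2)"
proof -
  \<comment> \<open>For \<open>j \<le> 0\<close> the power \<open>\<alpha> powi j\<close> would be
    at least 1, hence not below \<open>\<beta>\<close>.\<close>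
  have "0 < j"
  proof (rule ccontr)
    assume "\<not> 0 < j"
    then have "\<alpha> powi j = inverse (\<alpha> ^ nat (- j))" by (auto simp: power_int_def power_inverse)
    moreover have "1 \<le> inverse (\<alpha> ^ nat (- j))"
      using assms by (intro one_le_inverse) (auto simp: power_le_one)
    ultimately show False using assms by linarith
  qed
  define J where "J = nat j"
  have J: "1 \<le> J" "j = int J" using \<open>0 < j\<close> by (auto simp: J_def)
  have pw: "\<alpha> powi j = \<alpha> ^ J" "\<alpha> powi (j - 1) = \<alpha> ^ (J - 1)"
    using J by (auto simp: power_int_def nat_diff_distrib)
  have \<beta>: "0 < \<beta>" using assms zero_less_power[of \<alpha> J] pw by linarith
  note ctx = \<open>0 < \<alpha>\<close> less_imp_le[OF \<open>\<alpha> < 1\<close>] \<beta> \<open>n \<ge> 3\<close>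
  have le: "\<alpha> ^ J < \<beta>" "\<beta> \<le> \<alpha> ^ (J - 1)" using assms pw by simp_all
  show ?thesis unfolding pw
  proof (intro conjI impI; (elim conjE)?)
    assume *: "int n > j" "2 * \<alpha> ^ J < \<beta>"
    have "J < n" using * J by simp
    \<comment> \<open>The period is \<open>2 * J\<close> because \<open>n / j\<close> equals
      \<open>2 * n / (2 * j)\<close>.\<close>
    from ex_small_cycle_forcing_set[OF ctx le(2) J(1) this, of "2 * J"] obtain B where
      "transmission_zero_forcing_set \<alpha> \<beta> (cycle_graph n) B" "2 * J * card B < 2 * n + 2 * J"
      by auto
    then have "int (transmission_zero_forcing_number \<alpha> \<beta> (cycle_graph n)) = \<lceil>2 * real n / real (2 * J)\<rceil>"
      using J(1) cycle_forcing_card(2)[OF ctx _ le(1) \<open>\<beta> \<le> 1\<close> *(2)]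
      by (intro cycle_forcing_number_ceiling) auto
    then show "int (transmission_zero_forcing_number \<alpha> \<beta> (cycle_graph n)) = \<lceil>real n / real_of_int j\<rceil>"
      using J by simp
  next
    assume *: "int n > j" "\<beta> \<le> 2 * \<alpha> ^ J"
    have "J < n" using * J by simp
    from ex_small_cycle_forcing_set[OF ctx le(2) J(1) this, of "2 * J + 1"] *(2) obtain B where
      "transmission_zero_forcing_set \<alpha> \<beta> (cycle_graph n) B"
      "(2 * J + 1) * card B < 2 * n + (2 * J + 1)"
      by auto
    then have "int (transmission_zero_forcing_number \<alpha> \<beta> (cycle_graph n)) =
        \<lceil>2 * real n / real (2 * J + 1)\<rceil>"
      using cycle_forcing_card(1)[OF ctx _ le(1) \<open>\<beta> \<le> 1\<close>]
      by (intro cycle_forcing_number_ceiling) auto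
    then show "int (transmission_zero_forcing_number \<alpha> \<beta> (cycle_graph n)) =
        \<lceil>2 * real n / (2 * real_of_int j + 1)\<rceil>"
      using J by (simp add: add.commute)
  next
    assume "int n \<le> j"
    \<comment> \<open>One block of length \<open>2 * J\<close> contains the whole cycle, so a single
      pair suffices.\<close>
    then have "n \<le> 2 * J" "2 \<le> 2 * J" using J by auto
    then have "transmission_zero_forcing_set \<alpha> \<beta> (cycle_graph n) (block_pairs (2 * J) 1)"
      using \<open>n \<ge> 3\<close> by (intro block_pairs_forcing[OF ctx le(2)]) auto
    moreover have "card (block_pairs (2 * J) 1) = 2"
      using card_block_pairs[OF \<open>2 \<le> 2 * J\<close>, of 1] by simp
    ultimately show "transmission_zero_forcing_number \<alpha> \<beta> (cycle_graph n) = 2"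
      using cycle_forcing_card_ge_2[OF ctx] by (intro transmission_zero_forcing_number_eqI) auto
  qed
qed

end
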